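(* There are absolute constants $c,c_0>0$ such that the following two assertions hold. (1) Let $\gamma$ be a real number with $0<\gamma\le c_0$, let $d,n$ be positive integers with $d\ge 2/\gamma$ and $2d\mid n$, and let $G$ be the disjoint union of $n/(2d)$ copies of $K_{d,d}$. Then $$ i_\gamma(G)\ge 2^{n/2}\exp\left\{c\,\gamma\log(e/\gamma)\,n+c\,\frac nd\right\}. $$ (2) For every integer $d\ge 2$ and every positive integer $n$ with $2d\mid n$, if $G$ is the disjoint union of $n/(2d)$ copies of $K_{d,d}$, then $$ i_0(G)=(2^{d+1}-1)^{n/(2d)}\ge 2^{n/2}\exp\left\{c\,\frac nd\right\}. $$
   Context: Graphs are finite and simple, and $K_{d,d}$ is the complete bipartite graph with $d$ vertices on each side. For a graph $G$ and $A\subseteq V(G)$, $e_G(A)=e(G[A])$ denotes the number of edges of $G$ with both endpoints in $A$. For a $d$-regular graph $G$ on $n$ vertices and real $\gamma\ge 0$, $$ i_\gamma(G):=\bigl|\{A\subseteq V(G): e_G(A)\le \gamma d n\}\bigr|, $$ so that $i_0(G)$ is the number of independent sets of $G$ (including the empty set). Logarithms are natural, and $e$ inside $\log(e/\gamma)$ is Euler's number. "Absolute constants" means constants independent of $n$, $d$ and $\gamma$. *)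

theory Defs
  imports Complex_Main
begin

record 'a sgraph =
  verts :: "'a set"
  edges :: "'a set set"

definition simple_graph :: "'a sgraph \<Rightarrow> bool" where
  "simple_graph G \<longleftrightarrow>
     finite (verts G) \<and> edges G \<subseteq> {e. e \<subseteq> verts G \<and> card e = 2}"

definition induced :: "'a sgraph \<Rightarrow> 'a set \<Rightarrow> 'a sgraph" where
  "induced G A = \<lparr>verts = A, edges = {e \<in> edges G. e \<subseteq> A}\<rparr>"

definition num_edges :: "'a sgraph \<Rightarrow> nat" where
  "num_edges G = card (edges G)"

definition regular :: "'a sgraph \<Rightarrow> nat \<Rightarrow> bool" where
  "regular G d \<longleftrightarrow> (\<forall>v \<in> verts G. card {e \<in> edges G. v \<in> e} = d)"

definition independent :: "'a sgraph \<Rightarrow> 'a set \<Rightarrow> bool" where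
  "independent G A \<longleftrightarrow> A \<subseteq> verts G \<and> (\<forall>x \<in> A. \<forall>y \<in> A. {x, y} \<notin> edges G)"

text \<open>The number \<open>i_\<gamma>(G)\<close> of a \<open>d\<close>-regular graph \<open>G\<close> on \<open>n\<close> vertices. The degree \<open>d\<close> is
  an explicit argument, while \<open>n\<close> is read off from \<open>G\<close>; the definition is meant to be used
  only when \<open>G\<close> is \<open>d\<close>-regular.\<close>

definition i_gamma :: "real \<Rightarrow> nat \<Rightarrow> 'a sgraph \<Rightarrow> nat" where
  "i_gamma \<gamma> d G =
     card {A. A \<subseteq> verts G \<and>
              real (num_edges (induced G A)) \<le> \<gamma> * real d * real (card (verts G))}"

definition complete_bipartite :: "nat \<Rightarrow> nat \<Rightarrow> (nat + nat) sgraph" where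
  "complete_bipartite a b =
     \<lparr>verts = Inl ` {..<a} \<union> Inr ` {..<b},
      edges = {{Inl i, Inr j} | i j. i < a \<and> j < b}\<rparr>"

definition disjoint_copies :: "nat \<Rightarrow> 'a sgraph \<Rightarrow> (nat \<times> 'a) sgraph" where
  "disjoint_copies m H =
     \<lparr>verts = {..<m} \<times> verts H,
      edges = {Pair k ` e | k e. k < m \<and> e \<in> edges H}\<rparr>"

definition graph_iso :: "'a sgraph \<Rightarrow> 'b sgraph \<Rightarrow> bool" where
  "graph_iso G H \<longleftrightarrow>
     (\<exists>f. bij_betw f (verts G) (verts H) \<and> edges H = (\<lambda>e. f ` e) ` edges G)"

lemma simple_graph_complete_bipartite: "simple_graph (complete_bipartite a b)"
  by (auto simp: simple_graph_def complete_bipartite_def)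

lemma simple_graph_disjoint_copies:
  assumes "simple_graph H"
  shows "simple_graph (disjoint_copies m H)"
proof -
  have "card (Pair k ` e) = card e" for k :: nat and e :: "'a set"
    by (simp add: card_image inj_on_def)
  moreover have "Pair k ` e \<subseteq> {..<m} \<times> verts H" if "k < m" "e \<in> edges H" for k e
    using assms that by (auto simp: simple_graph_def)
  ultimately show ?thesis
    using assms unfolding simple_graph_def disjoint_copies_def by auto
qed

lemma card_verts_disjoint_copies_complete_bipartite:
  "card (verts (disjoint_copies m (complete_bipartite d d))) = 2 * d * m"
proof -
  have "card (Inl ` {..<d} \<union> Inr ` {..<d} :: (nat + nat) set) = 2 * d"
    by (subst card_Un_disjoint) (auto simp: card_image)
  then show ?thesis
    by (simp add: disjoint_copies_def complete_bipartite_def)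
qed

lemma regular_complete_bipartite: "regular (complete_bipartite d d) d"
proof -
  have "card {e. (\<exists>i j. e = {Inl i, Inr j} \<and> i < d \<and> j < d) \<and> Inl a \<in> e} = d"
    if "a < d" for a :: nat
  proof -
    have "{e. (\<exists>i j. e = {Inl i, Inr j} \<and> i < d \<and> j < d) \<and> Inl a \<in> e}
        = (\<lambda>j. {Inl a, Inr j :: nat + nat}) ` {..<d}"
      using that by auto
    moreover have "inj_on (\<lambda>j. {Inl a, Inr j :: nat + nat}) {..<d}"
      by (auto simp: inj_on_def doubleton_eq_iff)
    ultimately show ?thesis
      by (simp add: card_image)
  qed
  moreover have "card {e. (\<exists>i j. e = {Inl i, Inr j} \<and> i < d \<and> j < d) \<and> Inr b \<in> e} = d"
    if "b < d" for b :: nat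
  proof -
    have "{e. (\<exists>i j. e = {Inl i, Inr j} \<and> i < d \<and> j < d) \<and> Inr b \<in> e}
        = (\<lambda>i. {Inl i, Inr b :: nat + nat}) ` {..<d}"
      using that by auto
    moreover have "inj_on (\<lambda>i. {Inl i, Inr b :: nat + nat}) {..<d}"
      by (auto simp: inj_on_def doubleton_eq_iff)
    ultimately show ?thesis
      by (simp add: card_image)
  qed
  ultimately show ?thesis
    by (auto simp: regular_def complete_bipartite_def)
qed

lemma regular_disjoint_copies:
  assumes "regular H d"
  shows "regular (disjoint_copies m H) d"
proof -
  have "card {e \<in> edges (disjoint_copies m H). (k, v) \<in> e} = d"
    if "k < m" "v \<in> verts H" for k v
  proof -
    have "{e \<in> edges (disjoint_copies m H). (k, v) \<in> e}
        = (\<lambda>e. Pair k ` e) ` {e \<in> edges H. v \<in> e}"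
      using that by (auto simp: disjoint_copies_def)
    moreover have "inj_on (\<lambda>e. Pair k ` e) {e \<in> edges H. v \<in> e}"
      by (rule inj_onI) (simp add: inj_image_eq_iff inj_on_def)
    ultimately show ?thesis
      using assms that by (simp add: card_image regular_def)
  qed
  then show ?thesis
    by (auto simp: regular_def) (auto simp: disjoint_copies_def)
qed

lemma i_gamma_0_eq_card_independent:
  assumes "simple_graph G"
  shows "i_gamma 0 d G = card {A. independent G A}"
proof -
  have "finite (edges G)"
    using assms by (auto simp: simple_graph_def intro: finite_subset[of _ "Pow (verts G)"])
  moreover have "{e \<in> edges G. e \<subseteq> A} = {} \<longleftrightarrow> (\<forall>x \<in> A. \<forall>y \<in> A. {x, y} \<notin> edges G)" for A
  proof -
    have "\<exists>x y. e = {x, y}" if "e \<in> edges G" for e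
      using assms that unfolding simple_graph_def card_2_iff by blast
    then show ?thesis
      by fastforce
  qed
  ultimately have "{A. A \<subseteq> verts G \<and>
      real (num_edges (induced G A)) \<le> 0 * real d * real (card (verts G))}
      = {A. independent G A}"
    by (simp add: num_edges_def induced_def independent_def)
  then show ?thesis
    by (simp add: i_gamma_def)
qed

end

theory Submission
  imports Defs "HOL-Library.FuncSet"
begin

text \<open>
  Write \<open>n = 2dm\<close>, so that \<open>G\<close> consists of \<open>m\<close> copies of \<open>K\<^bsub>d,d\<^esub>\<close>. The number of edges spanned by
  a vertex set is the sum of the numbers spanned inside the copies, and the budget \<open>\<gamma>dn\<close> is the
  sum of \<open>m\<close> budgets \<open>2\<gamma>d\<^sup>2\<close>, one for each copy. A set that respects the budget in every copy
  respects the total one, so \<open>i\<^sub>\<gamma>(G) \<ge> i\<^sub>\<gamma>(K\<^bsub>d,d\<^esub>)\<^sup>m\<close> (\<open>i_gamma_disjoint_copies_ge\<close>); for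
  \<open>\<gamma> = 0\<close> the two conditions coincide and equality holds (\<open>i_gamma_0_disjoint_copies\<close>). This
  leaves a single \<open>K\<^bsub>d,d\<^esub>\<close>, where a set with parts of sizes \<open>a\<close> and \<open>b\<close> spans \<open>ab\<close> edges.

  For \<open>\<gamma> = 0\<close> one part must be empty, which gives \<open>2 \<cdot> 2\<^sup>d - 1\<close> sets; for \<open>d \<ge> 2\<close> this is at
  least \<open>7/4 \<cdot> 2\<^sup>d\<close>, and the factor \<open>7/4\<close> in each copy produces the factor \<open>exp (c n/d)\<close>.

  For \<open>\<gamma> > 0\<close> let \<open>t = \<lfloor>2\<gamma>d\<rfloor>\<close>. A set with exactly \<open>t\<close> vertices on the left and arbitrary ones on
  the right spans at most \<open>td \<le> 2\<gamma>d\<^sup>2\<close> edges, whence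
  \<open>i\<^sub>\<gamma>(K\<^bsub>d,d\<^esub>) \<ge> 2\<^sup>d (d choose t) \<ge> 2\<^sup>d (d/t)\<^sup>t \<ge> 2\<^sup>d (1/(2\<gamma>))\<^sup>t\<close>. The assumption \<open>\<gamma>d \<ge> 2\<close> makes the
  rounding in \<open>t\<close> harmless and lets the term \<open>n/d\<close> be absorbed into \<open>\<gamma> log (e/\<gamma>) n\<close>, while for
  \<open>\<gamma> \<le> 1/8\<close> the logarithms of \<open>1/(2\<gamma>)\<close> and \<open>e/\<gamma>\<close> are comparable (\<open>exp_le_binomial\<close>).
\<close>

section \<open>Invariance under isomorphism\<close>

lemma card_filter_bij_betw:
  assumes f: "bij_betw f X Y" and P: "\<And>x. x \<in> X \<Longrightarrow> P x \<longleftrightarrow> Q (f x)"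
  shows "card {x \<in> X. P x} = card {y \<in> Y. Q y}"
proof -
  have "f ` {x \<in> X. P x} = {y \<in> Y. Q y}"
    using f P by (auto simp: bij_betw_def)
  moreover have "inj_on f {x \<in> X. P x}"
    using f by (auto simp: bij_betw_def intro: inj_on_subset)
  ultimately show ?thesis
    using card_image by fastforce
qed

lemma num_edges_induced_image:
  assumes "simple_graph G" and f: "bij_betw f (verts G) (verts H)"
    and edges: "edges H = (\<lambda>e. f ` e) ` edges G" and A: "A \<subseteq> verts G"
  shows "num_edges (induced H (f ` A)) = num_edges (induced G A)"
proof -
  have inj: "inj_on f (verts G)"
    using f by (rule bij_betw_imp_inj_on)
  have sub: "e \<subseteq> verts G" if "e \<in> edges G" for e
    using assms(1) that by (auto simp: simple_graph_def)
  have "{e \<in> edges H. e \<subseteq> f ` A} = (\<lambda>e. f ` e) ` {e \<in> edges G. e \<subseteq> A}"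
    (is "?L = ?R")
  proof
    show "?L \<subseteq> ?R"
    proof
      fix e' assume "e' \<in> ?L"
      then obtain e where e: "e \<in> edges G" "e' = f ` e" "f ` e \<subseteq> f ` A"
        by (auto simp: edges)
      have "e \<subseteq> A"
        using e(3) sub[OF e(1)] A inj by (auto dest: inj_onD)
      with e show "e' \<in> ?R"
        by blast
    qed
  qed (auto simp: edges)
  moreover have "inj_on (\<lambda>e. f ` e) {e \<in> edges G. e \<subseteq> A}"
    using sub by (intro inj_onI) (simp add: inj_on_image_eq_iff[OF inj])
  ultimately show ?thesis
    by (simp add: num_edges_def induced_def card_image)
qed

lemma i_gamma_iso:
  assumes G: "simple_graph G" and iso: "graph_iso G H"
  shows "i_gamma \<gamma> d G = i_gamma \<gamma> d H"
proof -
  obtain f where f: "bij_betw f (verts G) (verts H)"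
    and edges: "edges H = (\<lambda>e. f ` e) ` edges G"
    using iso by (auto simp: graph_iso_def)
  have card: "card (verts H) = card (verts G)"
    using f by (simp add: bij_betw_same_card)
  note count = num_edges_induced_image[OF G f edges]
  have "card {A \<in> Pow (verts G). real (num_edges (induced G A)) \<le> \<gamma> * real d * real (card (verts G))}
      = card {A \<in> Pow (verts H). real (num_edges (induced H A)) \<le> \<gamma> * real d * real (card (verts H))}"
    using bij_betw_Pow[OF f] by (rule card_filter_bij_betw) (simp add: count card)
  then show ?thesis
    by (simp add: i_gamma_def)
qed

section \<open>Reduction to a single component\<close>

lemma bij_betw_Sigma_PiE:
  "bij_betw (Sigma I) (I \<rightarrow>\<^sub>E Pow V) (Pow (I \<times> V))"
proof (rule bij_betwI[where g = "\<lambda>A. \<lambda>i\<in>I. {v. (i, v) \<in> A}"])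
  show "(\<lambda>A. \<lambda>i\<in>I. {v. (i, v) \<in> A}) \<in> Pow (I \<times> V) \<rightarrow> (I \<rightarrow>\<^sub>E Pow V)"
    by auto
  fix F assume "F \<in> I \<rightarrow>\<^sub>E Pow V"
  then show "(\<lambda>i\<in>I. {v. (i, v) \<in> Sigma I F}) = F"
    by (intro ext) (simp add: PiE_def extensional_def)
qed auto

lemma num_edges_induced_disjoint_copies:
  assumes H: "simple_graph H"
  shows "num_edges (induced (disjoint_copies m H) (Sigma {..<m} F)) =
    (\<Sum>k<m. num_edges (induced H (F k)))"
proof -
  have fin: "finite (edges H)"
    using H by (auto simp: simple_graph_def intro: finite_subset[of _ "Pow (verts H)"])
  \<comment> \<open>Images of the empty set would coincide across the copies, so the edges have to be nonempty.\<close>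
  have disj: "Pair j ` e \<noteq> Pair k ` e'" if "e \<in> edges H" "j \<noteq> k" for j k :: nat and e e'
  proof -
    have "e \<noteq> {}"
      using H that(1) by (auto simp: simple_graph_def)
    with that(2) show ?thesis
      by blast
  qed
  have "{e \<in> edges (disjoint_copies m H). e \<subseteq> Sigma {..<m} F} =
      (\<Union>k<m. (\<lambda>e. Pair k ` e) ` {e \<in> edges H. e \<subseteq> F k})" (is "?L = ?R")
  proof (intro equalityI subsetI)
    fix x assume "x \<in> ?L"
    then obtain k e where "k < m" "e \<in> edges H" "x = Pair k ` e" "e \<subseteq> F k"
      by (auto simp: disjoint_copies_def)
    then show "x \<in> ?R"
      by blast
  next
    fix x assume "x \<in> ?R"
    then obtain k e where "k < m" "e \<in> edges H" "x = Pair k ` e" "e \<subseteq> F k"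
      by blast
    then show "x \<in> ?L"
      unfolding disjoint_copies_def by auto
  qed
  also have "card \<dots> = (\<Sum>k<m. card ((\<lambda>e. Pair k ` e) ` {e \<in> edges H. e \<subseteq> F k}))"
  proof (intro card_UN_disjoint ballI impI)
    fix j k :: nat assume "j \<noteq> k"
    show "(\<lambda>e. Pair j ` e) ` {e \<in> edges H. e \<subseteq> F j} \<inter>
        (\<lambda>e. Pair k ` e) ` {e \<in> edges H. e \<subseteq> F k} = {}"
      using disj[OF _ \<open>j \<noteq> k\<close>] by (fastforce simp: disjoint_iff)
  qed (use fin in auto)
  also have "\<dots> = (\<Sum>k<m. card {e \<in> edges H. e \<subseteq> F k})"
    by (intro sum.cong card_image refl inj_onI) (simp add: inj_image_eq_iff inj_on_def)
  finally show ?thesis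
    by (simp add: num_edges_def induced_def)
qed

lemma card_verts_disjoint_copies: "card (verts (disjoint_copies m H)) = m * card (verts H)"
  by (simp add: disjoint_copies_def card_cartesian_product)

text \<open>Both results on disjoint copies read a vertex set as a family of vertex sets of the
  components.\<close>

lemma i_gamma_disjoint_copies:
  assumes H: "simple_graph H"
  shows "i_gamma \<gamma> d (disjoint_copies m H) =
    card {F \<in> {..<m} \<rightarrow>\<^sub>E Pow (verts H).
      (\<Sum>k<m. real (num_edges (induced H (F k)))) \<le> \<gamma> * real d * (real m * real (card (verts H)))}"
    (is "_ = card ?S")
proof -
  let ?D = "disjoint_copies m H"
  have bij: "bij_betw (Sigma {..<m}) ({..<m} \<rightarrow>\<^sub>E Pow (verts H)) (Pow (verts ?D))"
    using bij_betw_Sigma_PiE by (simp add: disjoint_copies_def)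
  have "card ?S = card {A \<in> Pow (verts ?D).
      real (num_edges (induced ?D A)) \<le> \<gamma> * real d * real (card (verts ?D))}"
    using bij by (rule card_filter_bij_betw)
      (simp add: num_edges_induced_disjoint_copies[OF H] card_verts_disjoint_copies)
  then show ?thesis
    by (simp add: i_gamma_def)
qed

lemma i_gamma_disjoint_copies_ge:
  assumes H: "simple_graph H"
  shows "i_gamma \<gamma> d H ^ m \<le> i_gamma \<gamma> d (disjoint_copies m H)"
proof -
  let ?B = "\<gamma> * real d * real (card (verts H))"
  let ?T = "{A. A \<subseteq> verts H \<and> real (num_edges (induced H A)) \<le> ?B}"
  let ?S = "{F \<in> {..<m} \<rightarrow>\<^sub>E Pow (verts H).
      (\<Sum>k<m. real (num_edges (induced H (F k)))) \<le> \<gamma> * real d * (real m * real (card (verts H)))}"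
  have "({..<m} \<rightarrow>\<^sub>E ?T) \<subseteq> ?S"
  proof
    fix F assume F: "F \<in> {..<m} \<rightarrow>\<^sub>E ?T"
    then have "(\<Sum>k<m. real (num_edges (induced H (F k)))) \<le> (\<Sum>k<m. ?B)"
      by (intro sum_mono) (auto simp: PiE_iff)
    with F show "F \<in> ?S"
      by (auto simp: PiE_iff algebra_simps)
  qed
  moreover have "finite ?S"
    using H by (intro finite_subset[of ?S "{..<m} \<rightarrow>\<^sub>E Pow (verts H)"] finite_PiE)
      (auto simp: simple_graph_def)
  ultimately have "card ({..<m} \<rightarrow>\<^sub>E ?T) \<le> card ?S"
    by (intro card_mono)
  then show ?thesis
    by (simp add: i_gamma_disjoint_copies[OF H] card_PiE) (simp add: i_gamma_def)
qed

lemma i_gamma_0_disjoint_copies: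
  assumes H: "simple_graph H"
  shows "i_gamma 0 d (disjoint_copies m H) = i_gamma 0 d H ^ m"
proof -
  have "{F \<in> {..<m} \<rightarrow>\<^sub>E Pow (verts H). (\<Sum>k<m. real (num_edges (induced H (F k)))) \<le> 0}
      = ({..<m} \<rightarrow>\<^sub>E {A. A \<subseteq> verts H \<and> num_edges (induced H A) = 0})"
  proof -
    have "(\<Sum>k<m. real (num_edges (induced H (F k)))) \<le> 0 \<longleftrightarrow>
        (\<forall>k<m. num_edges (induced H (F k)) = 0)" for F
      using sum_nonneg_eq_0_iff[of "{..<m}" "\<lambda>k. real (num_edges (induced H (F k)))"]
        sum_nonneg[of "{..<m}" "\<lambda>k. real (num_edges (induced H (F k)))"]
      by auto
    then show ?thesis
      by (simp only:) (simp add: PiE_iff set_eq_iff Ball_def, blast)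
  qed
  then show ?thesis
    by (simp add: i_gamma_disjoint_copies[OF H] card_PiE) (simp add: i_gamma_def)
qed

section \<open>A single complete bipartite graph\<close>

lemma verts_complete_bipartite: "verts (complete_bipartite a b) = {..<a} <+> {..<b}"
  by (simp add: complete_bipartite_def Plus_def)

lemma num_edges_induced_complete_bipartite:
  assumes "X \<subseteq> {..<a}" "Y \<subseteq> {..<b}"
  shows "num_edges (induced (complete_bipartite a b) (X <+> Y)) = card X * card Y"
proof -
  have "{e \<in> edges (complete_bipartite a b). e \<subseteq> X <+> Y} = (\<lambda>(i, j). {Inl i, Inr j}) ` (X \<times> Y)"
    using assms by (auto simp: complete_bipartite_def)
  moreover have "inj_on (\<lambda>(i, j). {Inl i, Inr j :: nat + nat}) (X \<times> Y)"
    by (auto simp: inj_on_def doubleton_eq_iff)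
  ultimately show ?thesis
    by (simp add: num_edges_def induced_def card_image card_cartesian_product)
qed

lemma i_gamma_complete_bipartite:
  "i_gamma \<gamma> d (complete_bipartite d d) =
    card {(X, Y). X \<subseteq> {..<d} \<and> Y \<subseteq> {..<d} \<and> real (card X * card Y) \<le> 2 * \<gamma> * (real d)\<^sup>2}"
    (is "_ = card ?S")
proof -
  let ?K = "complete_bipartite d d"
  have budget: "\<gamma> * real d * real (card (verts ?K)) = 2 * \<gamma> * (real d)\<^sup>2"
    by (simp add: verts_complete_bipartite card_Plus power2_eq_square)
  have "bij_betw (\<lambda>(X, Y). X <+> Y) (Pow {..<d} \<times> Pow {..<d}) (Pow (verts ?K))"
    by (rule bij_betwI[where g = "\<lambda>A. (Inl -` A, Inr -` A)"])
      (auto simp: verts_complete_bipartite)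
  then have "card {p \<in> Pow {..<d} \<times> Pow {..<d}.
        real (card (fst p) * card (snd p)) \<le> 2 * \<gamma> * (real d)\<^sup>2} =
      card {A \<in> Pow (verts ?K).
        real (num_edges (induced ?K A)) \<le> \<gamma> * real d * real (card (verts ?K))}"
    by (rule card_filter_bij_betw) (auto simp: budget num_edges_induced_complete_bipartite)
  moreover have "{p \<in> Pow {..<d} \<times> Pow {..<d}.
      real (card (fst p) * card (snd p)) \<le> 2 * \<gamma> * (real d)\<^sup>2} = ?S"
    by auto
  ultimately show ?thesis
    by (simp add: i_gamma_def)
qed

lemma i_gamma_0_complete_bipartite:
  "real (i_gamma 0 d (complete_bipartite d d)) = 2 ^ (d + 1) - 1"
proof -
  let ?P = "Pow {..<d}"
  have empty: "real (card X * card Y) \<le> 2 * 0 * (real d)\<^sup>2 \<longleftrightarrow> X = {} \<or> Y = {}"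
    if "X \<subseteq> {..<d}" "Y \<subseteq> {..<d}" for X Y
    using that[THEN finite_subset] by (simp flip: of_nat_mult)
  have "{(X, Y). X \<subseteq> {..<d} \<and> Y \<subseteq> {..<d} \<and> real (card X * card Y) \<le> 2 * 0 * (real d)\<^sup>2}
      = {{}} \<times> ?P \<union> ?P \<times> {{}}"
    using empty by auto
  moreover have "({{}} \<times> ?P) \<inter> (?P \<times> {{}}) = {({}, {})}"
    by auto
  then have "card ({{}} \<times> ?P \<union> ?P \<times> {{}}) + 1 = 2 ^ d + 2 ^ d"
    using card_Un_Int[of "{{}} \<times> ?P" "?P \<times> {{}}"]
    by (simp add: card_cartesian_product card_Pow)
  then have "real (card ({{}} \<times> ?P \<union> ?P \<times> {{}}) + 1) = real (2 ^ d + 2 ^ d)"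
    by (simp only:)
  ultimately show ?thesis
    by (simp add: i_gamma_complete_bipartite)
qed

lemma i_gamma_complete_bipartite_ge:
  assumes t: "real t \<le> 2 * \<gamma> * real d"
  shows "2 ^ d * (d choose t) \<le> i_gamma \<gamma> d (complete_bipartite d d)"
proof -
  let ?X = "{X. X \<subseteq> {..<d} \<and> card X = t}"
  let ?S = "{(X, Y). X \<subseteq> {..<d} \<and> Y \<subseteq> {..<d} \<and> real (card X * card Y) \<le> 2 * \<gamma> * (real d)\<^sup>2}"
  have "?X \<times> Pow {..<d} \<subseteq> ?S"
  proof (clarsimp)
    fix X Y assume Y: "Y \<subseteq> {..<d}" and "t = card X"
    have "card Y \<le> d"
      using card_mono[OF _ Y] by simp
    then have "real t * real (card Y) \<le> (2 * \<gamma> * real d) * real d"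
      using t by (intro mult_mono) auto
    then show "real (card X) * real (card Y) \<le> 2 * \<gamma> * (real d)\<^sup>2"
      using \<open>t = card X\<close> by (simp add: power2_eq_square)
  qed
  moreover have "finite ?S"
    by (rule finite_subset[of _ "Pow {..<d} \<times> Pow {..<d}"]) auto
  ultimately have "card (?X \<times> Pow {..<d}) \<le> card ?S"
    by (intro card_mono)
  then show ?thesis
    by (simp add: i_gamma_complete_bipartite card_cartesian_product card_Pow n_subsets mult.commute)
qed

section \<open>Estimates\<close>

text \<open>Since \<open>1/\<gamma> \<ge> 8\<close>, halving \<open>1/\<gamma>\<close> costs at most a third of its logarithm. Multiplying
  by \<open>e\<close> adds at most two thirds, because \<open>ln 8 = 3 ln 2 \<ge> 3/2\<close>. So the ratio of the two logarithms is at
  least \<open>2/5\<close>.\<close>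

lemma ln_e_div_le:
  fixes \<gamma> :: real
  assumes "0 < \<gamma>" "\<gamma> \<le> 1/8"
  shows "ln (exp 1 / \<gamma>) / 3 \<le> ln (1 / (2 * \<gamma>))"
proof -
  have ln8: "ln 8 = 3 * ln (2::real)"
    using ln_realpow[of "2::real" 3] by simp
  have "ln 8 \<le> ln (1 / \<gamma>)"
    using assms by (simp add: field_simps)
  moreover have "1 - 1 / 2 \<le> ln (2::real)"
    using ln_le_minus_one[of "1/2::real"] by (simp add: ln_div)
  ultimately show ?thesis
    using assms by (simp add: ln_div ln_mult ln8)
qed

text \<open>The choice is \<open>t = \<lfloor>2\<gamma>d\<rfloor>\<close>: then \<open>t \<ge> 2\<gamma>d - 1 \<ge> 3/2 \<gamma>d\<close>, and each of the \<open>t\<close> factors \<open>d/t\<close>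
  is at least \<open>1/(2\<gamma>)\<close>. This gives an exponent of \<open>1/2 \<gamma>d log (e/\<gamma>)\<close>, which is ample room for both
  terms on the left, the second being at most half of the first as \<open>\<gamma>d \<ge> 2\<close>.\<close>

lemma exp_le_binomial:
  fixes \<gamma> :: real and d :: nat
  assumes \<gamma>: "0 < \<gamma>" "\<gamma> \<le> 1/8" and d: "2 \<le> \<gamma> * real d"
  obtains t where "real t \<le> 2 * \<gamma> * real d"
    and "exp (1/10 * (2 * \<gamma> * ln (exp 1 / \<gamma>) * real d) + 1/10 * 2) \<le> real (d choose t)"
proof
  define t where "t = nat \<lfloor>2 * \<gamma> * real d\<rfloor>"
  define L where "L = ln (exp 1 / \<gamma>)"
  show t_le: "real t \<le> 2 * \<gamma> * real d"
    using d by (simp add: t_def)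
  have t_ge: "3/2 * (\<gamma> * real d) \<le> real t"
    using d unfolding t_def by linarith
  have L_ge: "1 \<le> L"
    using \<gamma> by (simp add: L_def ln_div)
  have L_le: "L / 3 \<le> ln (1 / (2 * \<gamma>))"
    using ln_e_div_le[OF \<gamma>] by (simp add: L_def)
  have "\<gamma> * real d \<le> 1/8 * real d"
    using \<gamma> by (intro mult_right_mono) auto
  with t_le have "t \<le> d"
    by linarith
  have t_pos: "0 < real t"
    using t_ge d by linarith
  have \<gamma>dL: "2 * 1 \<le> \<gamma> * real d * L"
    using d L_ge by (intro mult_mono) auto
  have "1/10 * (2 * \<gamma> * L * real d) + 1/10 * 2 \<le> (3/2 * (\<gamma> * real d)) * (L / 3)"
    using \<gamma>dL by (simp add: algebra_simps)
  also have "\<dots> \<le> real t * ln (1 / (2 * \<gamma>))"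
    using t_ge L_le L_ge d by (intro mult_mono) auto
  finally have "exp (1/10 * (2 * \<gamma> * L * real d) + 1/10 * 2) \<le> exp (real t * ln (1 / (2 * \<gamma>)))"
    by simp
  also have "\<dots> = (1 / (2 * \<gamma>)) ^ t"
    using \<gamma> by (simp add: exp_of_nat_mult)
  also have "\<dots> \<le> (real d / real t) ^ t"
    using t_le t_pos \<gamma> by (intro power_mono) (simp_all add: field_simps)
  also have "\<dots> \<le> real (d choose t)"
    using binomial_ge_n_over_k_pow_k[OF \<open>t \<le> d\<close>, where 'a = real] by simp
  finally show "exp (1/10 * (2 * \<gamma> * ln (exp 1 / \<gamma>) * real d) + 1/10 * 2) \<le> real (d choose t)"
    by (simp add: L_def)
qed

text \<open>The exponent is \<open>c n/d\<close> for one component, where \<open>n = 2d\<close> and \<open>c = 1/10\<close>.\<close>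

lemma exp_fifth_le: "exp (1/10 * 2) \<le> (7/4 :: real)"
  using exp_bound[of "1/5 :: real"] by (simp add: power2_eq_square)

lemma two_powr_mult_exp_eq_power:
  fixes x :: real
  shows "2 powr (real (2 * d * m) / 2) * exp (real m * x) = (2 ^ d * exp x) ^ m"
proof -
  have "2 powr (real (2 * d * m) / 2) = 2 powr real (d * m)"
    by simp
  also have "\<dots> = (2 ^ d) ^ m"
    by (subst powr_realpow) (simp_all add: power_mult)
  finally show ?thesis
    by (simp add: exp_of_nat_mult power_mult_distrib)
qed

theorem proposition1p2:
  "\<exists>c c\<^sub>0 :: real. c > 0 \<and> c\<^sub>0 > 0 \<and>
     (\<forall>(\<gamma> :: real) (d :: nat) (n :: nat) (G :: nat sgraph).
        0 < \<gamma> \<and> \<gamma> \<le> c\<^sub>0 \<and> d > 0 \<and> n > 0 \<and> real d \<ge> 2 / \<gamma> \<and> 2 * d dvd n \<and>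
        simple_graph G \<and>
        graph_iso G (disjoint_copies (n div (2 * d)) (complete_bipartite d d)) \<longrightarrow>
        real (i_gamma \<gamma> d G) \<ge>
          2 powr (real n / 2) *
          exp (c * \<gamma> * ln (exp 1 / \<gamma>) * real n + c * (real n / real d))) \<and>
     (\<forall>(d :: nat) (n :: nat) (G :: nat sgraph).
        d \<ge> 2 \<and> n > 0 \<and> 2 * d dvd n \<and>
        simple_graph G \<and>
        graph_iso G (disjoint_copies (n div (2 * d)) (complete_bipartite d d)) \<longrightarrow>
        real (i_gamma 0 d G) = (2 ^ (d + 1) - 1) ^ (n div (2 * d)) \<and>
        (2 ^ (d + 1) - 1 :: real) ^ (n div (2 * d)) \<ge>
          2 powr (real n / 2) * exp (c * (real n / real d)))"
proof (rule exI[of _ "1/10"], rule exI[of _ "1/8"], intro conjI allI impI; (elim conjE)?)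
  fix \<gamma> :: real and d n :: nat and G :: "nat sgraph"
  assume \<gamma>: "0 < \<gamma>" "\<gamma> \<le> 1/8" and d: "0 < d" "2 / \<gamma> \<le> real d" and n: "2 * d dvd n"
    and G: "simple_graph G"
    and iso: "graph_iso G (disjoint_copies (n div (2 * d)) (complete_bipartite d d))"
  obtain m where m: "n = 2 * d * m"
    using n by (elim dvdE)
  let ?K = "complete_bipartite d d"
  let ?x = "1/10 * (2 * \<gamma> * ln (exp 1 / \<gamma>) * real d) + 1/10 * 2"
  have "2 \<le> \<gamma> * real d"
    using \<gamma> d by (simp add: field_simps)
  then obtain t where t: "real t \<le> 2 * \<gamma> * real d" "exp ?x \<le> real (d choose t)"
    using exp_le_binomial[OF \<gamma>] by blast
  have "2 powr (real n / 2) *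
      exp (1/10 * \<gamma> * ln (exp 1 / \<gamma>) * real n + 1/10 * (real n / real d)) =
      2 powr (real (2 * d * m) / 2) * exp (real m * ?x)"
    using d by (simp add: m field_simps)
  also have "\<dots> = (2 ^ d * exp ?x) ^ m"
    by (rule two_powr_mult_exp_eq_power)
  also have "\<dots> \<le> (2 ^ d * real (d choose t)) ^ m"
    using t(2) by (intro power_mono mult_left_mono) auto
  also have "\<dots> = real ((2 ^ d * (d choose t)) ^ m)"
    by simp
  also have "\<dots> \<le> real (i_gamma \<gamma> d ?K ^ m)"
    using i_gamma_complete_bipartite_ge[OF t(1)] by (intro of_nat_mono power_mono) auto
  also have "\<dots> \<le> real (i_gamma \<gamma> d (disjoint_copies m ?K))"
    by (intro of_nat_mono i_gamma_disjoint_copies_ge simple_graph_complete_bipartite)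
  also have "\<dots> = real (i_gamma \<gamma> d G)"
    using i_gamma_iso[OF G iso] d by (simp add: m)
  finally show "2 powr (real n / 2) *
      exp (1/10 * \<gamma> * ln (exp 1 / \<gamma>) * real n + 1/10 * (real n / real d)) \<le>
      real (i_gamma \<gamma> d G)" .
next
  fix d n :: nat and G :: "nat sgraph"
  assume d: "2 \<le> d" and n: "2 * d dvd n" and G: "simple_graph G"
    and iso: "graph_iso G (disjoint_copies (n div (2 * d)) (complete_bipartite d d))"
  show "real (i_gamma 0 d G) = (2 ^ (d + 1) - 1) ^ (n div (2 * d))"
    by (simp add: i_gamma_iso[OF G iso]
        i_gamma_0_disjoint_copies[OF simple_graph_complete_bipartite]
        i_gamma_0_complete_bipartite del: power_Suc)
next
  fix d n :: nat
  assume d: "2 \<le> d" and n: "2 * d dvd n"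
  obtain m where m: "n = 2 * d * m"
    using n by (elim dvdE)
  have "(2::real) ^ 2 \<le> 2 ^ d"
    using d by (intro power_increasing) auto
  then have "2 ^ d * (7/4) \<le> (2 ^ (d + 1) - 1 :: real)"
    by simp
  moreover have "2 ^ d * exp (1/10 * 2) \<le> (2 ^ d * (7/4) :: real)"
    by (intro mult_left_mono exp_fifth_le) auto
  ultimately have step: "2 ^ d * exp (1/10 * 2) \<le> (2 ^ (d + 1) - 1 :: real)"
    by (rule order_trans[rotated])
  have "2 powr (real n / 2) * exp (1/10 * (real n / real d)) =
      2 powr (real (2 * d * m) / 2) * exp (real m * (1/10 * 2))"
    using d by (simp add: m field_simps)
  also have "\<dots> = (2 ^ d * exp (1/10 * 2)) ^ m"
    by (rule two_powr_mult_exp_eq_power)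
  also have "\<dots> \<le> (2 ^ (d + 1) - 1) ^ m"
    using step by (intro power_mono) auto
  finally show "2 powr (real n / 2) * exp (1/10 * (real n / real d)) \<le>
      (2 ^ (d + 1) - 1 :: real) ^ (n div (2 * d))"
    using d by (simp add: m)
qed simp_all

end
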